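(* Let $G$ be a graph with an even number $n\geq 4$ of vertices. Then $\mathrm{mp}(G)=n-2$ if and only if $\delta(G)=n-2$.
   Context: All graphs are finite, simple and undirected; $\delta(G)$ is the minimum degree. A perfect matching is a set of edges covering every vertex exactly once; an almost-perfect matching is a set of edges covering every vertex except one exactly once and missing the remaining vertex. The matching preclusion number $\mathrm{mp}(G)$ is the minimum number of edges whose deletion leaves a graph with neither a perfect matching nor an almost-perfect matching ($\mathrm{mp}(G)=0$ if $G$ has neither). *)

theory Defs
  imports Main
begin

definition simple_graph :: "'a set \<Rightarrow> 'a set set \<Rightarrow> bool" where
  "simple_graph V E \<longleftrightarrow> finite V \<and> E \<subseteq> {e. e \<subseteq> V \<and> card e = 2}"

definition degree :: "'a set set \<Rightarrow> 'a \<Rightarrow> nat" where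
  "degree E v = card {e \<in> E. v \<in> e}"

definition min_degree :: "'a set \<Rightarrow> 'a set set \<Rightarrow> nat" where
  "min_degree V E = Min (degree E ` V)"

definition perfect_matching :: "'a set \<Rightarrow> 'a set set \<Rightarrow> 'a set set \<Rightarrow> bool" where
  "perfect_matching V E M \<longleftrightarrow> M \<subseteq> E \<and> (\<forall>v\<in>V. \<exists>!e. e \<in> M \<and> v \<in> e)"

definition almost_perfect_matching :: "'a set \<Rightarrow> 'a set set \<Rightarrow> 'a set set \<Rightarrow> bool" where
  "almost_perfect_matching V E M \<longleftrightarrow>
     M \<subseteq> E \<and>
     (\<exists>w\<in>V. (\<forall>e\<in>M. w \<notin> e) \<and> (\<forall>v\<in>V - {w}. \<exists>!e. e \<in> M \<and> v \<in> e))"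

definition matching_precluding :: "'a set \<Rightarrow> 'a set set \<Rightarrow> 'a set set \<Rightarrow> bool" where
  "matching_precluding V E F \<longleftrightarrow>
     F \<subseteq> E \<and>
     (\<nexists>M. perfect_matching V (E - F) M) \<and>
     (\<nexists>M. almost_perfect_matching V (E - F) M)"

text \<open>The matching preclusion number. It is an unspecified number if no set of edges is
  matching precluding, which happens only for graphs with at most one vertex.\<close>

definition mp :: "'a set \<Rightarrow> 'a set set \<Rightarrow> nat" where
  "mp V E = (LEAST k. \<exists>F. matching_precluding V E F \<and> card F = k)"

lemma mp_eq_0:
  assumes "\<nexists>M. perfect_matching V E M" and "\<nexists>M. almost_perfect_matching V E M"
  shows "mp V E = 0"
proof -
  have "matching_precluding V E {}"
    using assms by (simp add: matching_precluding_def)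
  then have "\<exists>F. matching_precluding V E F \<and> card F = 0"
    by (intro exI[of _ "{}"]) simp
  then show ?thesis
    unfolding mp_def by (rule Least_eq_0)
qed

lemma matching_precluding_all_edges:
  assumes "finite V" and "card V \<ge> 2"
  shows "matching_precluding V E E"
proof -
  have "V - {w} \<noteq> {}" for w
  proof
    assume "V - {w} = {}"
    then have "card V \<le> card {w}"
      by (intro card_mono) auto
    then show False using assms by simp
  qed
  moreover from this have "V \<noteq> {}" by blast
  ultimately show ?thesis
    by (fastforce simp: matching_precluding_def perfect_matching_def almost_perfect_matching_def)
qed

end

theory Submission
  imports Defs "HOL-Number_Theory.Cong"
begin

text \<open>For even \<open>n\<close> the complete graph on \<open>n\<close> vertices splits into \<open>n - 1\<close> disjoint perfect
  matchings, the rounds of a round-robin tournament. If \<open>\<delta>(G) \<ge> n - 2\<close>, the non-edges of \<open>G\<close> form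
  a matching, so the vertices can be labelled such that all non-edges lie in a single round; the
  other \<open>n - 2\<close> rounds are disjoint perfect matchings of \<open>G\<close>, and a matching precluding set meets
  each of them. Conversely \<open>mp(G) \<le> \<delta>(G)\<close>, as isolating a vertex precludes perfect
  matchings and almost-perfect ones are ruled out by parity; and if \<open>\<delta>(G) = n - 1\<close>, all \<open>n - 1\<close>
  rounds are available, so \<open>mp(G) \<ge> n - 1\<close>.\<close>

section \<open>Edge colourings of the complete graph\<close>

text \<open>The colouring \<open>k\<close> of the edges of the complete graph on \<open>V\<close> is
  given on ordered pairs of end points. It is meant for symmetric \<open>k\<close>; otherwise one
  edge could belong to two classes.\<close>

definition colour_class :: "'a set \<Rightarrow> ('a \<Rightarrow> 'a \<Rightarrow> 'c) \<Rightarrow> 'c \<Rightarrow> 'a set set" where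
  "colour_class V k c = {{u, v} | u v. u \<in> V \<and> v \<in> V \<and> u \<noteq> v \<and> k u v = c}"

lemma colour_class_pairs: "colour_class V k c \<subseteq> {e. e \<subseteq> V \<and> card e = 2}"
  by (auto simp: colour_class_def)

lemma colour_class_eq:
  assumes "\<And>u v. k u v = k v u" "e \<in> colour_class V k c" "e \<in> colour_class V k d"
  shows "c = d"
proof -
  obtain u v where "e = {u, v}" "k u v = c"
    using assms(2) by (auto simp: colour_class_def)
  moreover obtain x y where "e = {x, y}" "k x y = d"
    using assms(3) by (auto simp: colour_class_def)
  ultimately show ?thesis
    using assms(1)[of u v] by (auto simp: doubleton_eq_iff)
qed

text \<open>The bijections say that each vertex sees every colour of \<open>C\<close> exactly once,
  so it has exactly one partner along an edge of colour \<open>c\<close>.\<close>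

lemma perfect_matching_colour_class:
  assumes sym: "\<And>u v. k u v = k v u"
    and bij: "\<And>v. v \<in> V \<Longrightarrow> bij_betw (k v) (V - {v}) C"
    and "c \<in> C" and sub: "colour_class V k c \<subseteq> E"
  shows "perfect_matching V E (colour_class V k c)"
  unfolding perfect_matching_def
proof (intro conjI ballI sub)
  fix v assume v: "v \<in> V"
  obtain u where u: "u \<in> V - {v}" "k v u = c"
    using bij[OF v] \<open>c \<in> C\<close> unfolding bij_betw_def by blast
  have uniq: "x = u" if "x \<in> V - {v}" "k v x = c" for x
    using bij[OF v] u that unfolding bij_betw_def by (auto dest: inj_onD)
  show "\<exists>!e. e \<in> colour_class V k c \<and> v \<in> e"
  proof (intro ex1I conjI)
    show "{v, u} \<in> colour_class V k c"
      using u v by (auto simp: colour_class_def)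
    fix e assume "e \<in> colour_class V k c \<and> v \<in> e"
    then obtain x where "e = {v, x}" "x \<in> V - {v}" "k v x = c"
      using sym by (fastforce simp: colour_class_def)
    then show "e = {v, u}"
      using uniq by blast
  qed simp
qed

lemma perfect_matching_disjoint:
  assumes "perfect_matching V E M" "E \<subseteq> Pow V"
  shows "pairwise disjnt M"
  using assms unfolding perfect_matching_def pairwise_def disjnt_def by blast

section \<open>The round-robin colouring\<close>

text \<open>The label \<open>m\<close> plays the point at infinity of the tournament on \<open>{..m}\<close>.\<close>

definition round_robin :: "nat \<Rightarrow> nat \<Rightarrow> nat \<Rightarrow> nat" where
  "round_robin m u v = (if u = m then v + v else if v = m then u + u else u + v) mod m"

lemma round_robin_commute: "round_robin m u v = round_robin m v u"
  by (simp add: round_robin_def add.commute)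

text \<open>Both sets have \<open>m\<close> elements, so injectivity suffices. At the point
  \<open>m\<close> the colours are the doubles modulo \<open>m\<close>, distinct because
  \<open>m\<close> is odd. At \<open>v < m\<close> they are the shifts \<open>v + x\<close> with
  \<open>x \<noteq> v\<close>, and the point \<open>m\<close> receives the missing colour
  \<open>v + v\<close>.\<close>

lemma bij_betw_round_robin:
  assumes "odd m" "v \<le> m"
  shows "bij_betw (round_robin m v) ({..m} - {v}) {..<m}"
proof -
  have double: "x = y" if "(x + x) mod m = (y + y) mod m" "x < m" "y < m" for x y
  proof -
    have "[2 * x = 2 * y] (mod m)"
      using that by (simp add: cong_def mult_2)
    moreover have "coprime 2 m"
      using \<open>odd m\<close> by simp
    ultimately have "[x = y] (mod m)"
      using cong_mult_lcancel_nat by blast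
    then show ?thesis
      using that by (simp add: cong_def)
  qed
  have shift: "x = y" if "(v + x) mod m = (v + y) mod m" "x < m" "y < m" for x y
  proof -
    have "[x = y] (mod m)"
      using that cong_add_lcancel_nat unfolding cong_def by blast
    then show ?thesis
      using that by (simp add: cong_def)
  qed
  have inj: "inj_on (round_robin m v) ({..m} - {v})"
  proof (rule inj_onI)
    fix x y
    assume "x \<in> {..m} - {v}" "y \<in> {..m} - {v}" "round_robin m v x = round_robin m v y"
    \<comment> \<open>The last two instances of \<open>shift\<close> treat the case that
      \<open>v < m\<close> and exactly one of \<open>x\<close>, \<open>y\<close> is
      \<open>m\<close>: its colour \<open>v + v\<close> would force the other one to be
      \<open>v\<close>, which is excluded.\<close>
    then show "x = y"
      using double[of x y] shift[of x y] shift[of x v] shift[of v y] assms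
      by (auto simp: round_robin_def split: if_splits)
  qed
  have "round_robin m v ` ({..m} - {v}) \<subseteq> {..<m}"
    using odd_pos[OF \<open>odd m\<close>] by (auto simp: round_robin_def)
  moreover have "card (round_robin m v ` ({..m} - {v})) = card {..<m}"
    using card_image[OF inj] assms by simp
  ultimately have "round_robin m v ` ({..m} - {v}) = {..<m}"
    by (intro card_subset_eq) auto
  with inj show ?thesis
    by (simp add: bij_betw_def)
qed

section \<open>Fitting a matching into a single round\<close>

text \<open>Disjoint pairs can be sent one by one to the edges of \<open>P\<close>. The induction
  removes an edge \<open>p\<close> from \<open>P\<close> and a pair \<open>q\<close> from
  \<open>V\<close>, and lets \<open>q\<close> go onto \<open>p\<close>.\<close>

lemma matching_embeds_into_matching:
  assumes "finite P" "\<And>e. e \<in> P \<Longrightarrow> card e = 2" "pairwise disjnt P"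
    and "finite V" "card V = card (\<Union>P)"
    and "N \<subseteq> {e. e \<subseteq> V \<and> card e = 2}" "pairwise disjnt N"
  shows "\<exists>h. bij_betw h V (\<Union>P) \<and> (\<forall>e\<in>N. h ` e \<in> P)"
  using assms
proof (induction P arbitrary: V N rule: finite_induct)
  case empty
  then have "V = {}" "N = {}"
    by auto
  then show ?case
    by (simp add: bij_betw_def)
next
  case (insert p P)
  obtain c d where p: "p = {c, d}" "c \<noteq> d"
    using insert.prems(1)[of p] by (auto simp: card_2_iff)
  have disj: "p \<inter> \<Union>P = {}"
    using insert.prems(2) insert.hyps(2) by (auto simp: pairwise_insert disjnt_def)
  have fin: "finite (\<Union>P)"
  proof (rule finite_Union)
    show "finite e" if "e \<in> P" for e
      using insert.prems(1)[of e] that by (intro card_ge_0_finite) simp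
  qed (rule insert.hyps(1))
  have card: "card V = 2 + card (\<Union>P)"
    using insert.prems(4) card_Un_disjoint[OF _ fin disj] p by simp
  \<comment> \<open>While \<open>N\<close> has edges, \<open>q\<close> is one of them. Once
    \<open>N\<close> is exhausted, any two vertices serve, as only the bijection remains to be
    completed.\<close>
  obtain q where q: "q \<subseteq> V" "card q = 2" "q \<in> N \<or> N = {}"
  proof (cases "N = {}")
    case True
    have "2 \<le> card V"
      using card by simp
    then obtain q where "q \<subseteq> V" "card q = 2"
      by (rule obtain_subset_with_card_n)
    then show ?thesis
      using True that by simp
  next
    case False
    then show ?thesis
      using that insert.prems(5) by blast
  qed
  obtain a b where ab: "q = {a, b}" "a \<noteq> b"
    using q(2) by (auto simp: card_2_iff)
  have qN: "e \<inter> q = {}" if "e \<in> N - {q}" for e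
    using that q(3) insert.prems(6) by (auto simp: pairwise_def disjnt_def)
  have "\<exists>h. bij_betw h (V - q) (\<Union>P) \<and> (\<forall>e\<in>N - {q}. h ` e \<in> P)"
  proof (rule insert.IH)
    show "card (V - q) = card (\<Union>P)"
      using card q insert.prems(3) by (simp add: card_Diff_subset finite_subset)
    show "N - {q} \<subseteq> {e. e \<subseteq> V - q \<and> card e = 2}"
      using insert.prems(5) qN by blast
    show "pairwise disjnt (N - {q})"
      using insert.prems(6) by (rule pairwise_subset) auto
  qed (use insert.prems in \<open>auto simp: pairwise_insert\<close>)
  then obtain h where h: "bij_betw h (V - q) (\<Union>P)" "\<And>e. e \<in> N - {q} \<Longrightarrow> h ` e \<in> P"
    by blast
  \<comment> \<open>The induction hypothesis says nothing about \<open>h\<close> on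
    \<open>q\<close>, so \<open>h\<close> is overridden there to map \<open>q\<close> onto
    \<open>p\<close>.\<close>
  define g where "g x = (if x = a then c else if x = b then d else h x)" for x
  have hg: "h x = g x" if "x \<notin> q" for x
    using that ab by (simp add: g_def)
  have "bij_betw g (V - q) (\<Union>P)"
    using h(1) bij_betw_cong[of "V - q" h g] hg by auto
  moreover have "bij_betw g q p"
    using ab p by (auto simp: bij_betw_def g_def)
  ultimately have "bij_betw g ((V - q) \<union> q) (\<Union>P \<union> p)"
    using disj by (intro bij_betw_combine) auto
  moreover have "(V - q) \<union> q = V" "\<Union>P \<union> p = \<Union>(insert p P)"
    using q by auto
  ultimately have "bij_betw g V (\<Union>(insert p P))"
    by simp
  moreover have "g ` e \<in> insert p P" if "e \<in> N" for e
  proof (cases "e = q")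
    case True
    then show ?thesis
      using ab p by (auto simp: g_def)
  next
    case False
    then have "e \<inter> q = {}"
      using that qN by simp
    then have "g ` e = h ` e"
      by (intro image_cong) (auto simp: hg[symmetric] disjoint_iff)
    then show ?thesis
      using that False h(2) by simp
  qed
  ultimately show ?case
    by blast
qed

text \<open>A relabelling \<open>h\<close> of the vertices sends \<open>N\<close> into round 0.
  Pulling all rounds back along \<open>h\<close> gives disjoint perfect matchings, and only the one
  for round 0 can meet \<open>N\<close>.\<close>

lemma disjoint_perfect_matchings:
  assumes "finite V" "card V = Suc m" "odd m"
    and N: "N \<subseteq> {e. e \<subseteq> V \<and> card e = 2}" "pairwise disjnt N"
  obtains M where "\<And>c. c < m \<Longrightarrow> perfect_matching V {e. e \<subseteq> V \<and> card e = 2} (M c)"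
    and "\<And>c d. c \<noteq> d \<Longrightarrow> M c \<inter> M d = {}"
    and "\<And>c. c \<noteq> 0 \<Longrightarrow> M c \<inter> N = {}"
proof -
  let ?k = "round_robin m"
  let ?P = "colour_class {..m} ?k 0"
  let ?K = "{e. e \<subseteq> {..m} \<and> card e = 2}"
  have pm: "perfect_matching {..m} ?K ?P"
    using odd_pos[OF \<open>odd m\<close>] bij_betw_round_robin[OF \<open>odd m\<close>]
    by (intro perfect_matching_colour_class[where C = "{..<m}"])
      (auto simp: round_robin_commute colour_class_pairs)
  have PK: "?P \<subseteq> ?K"
    by (rule colour_class_pairs)
  have "\<Union>?P = {..m}"
    using pm PK unfolding perfect_matching_def by blast
  moreover have "\<exists>h. bij_betw h V (\<Union>?P) \<and> (\<forall>e\<in>N. h ` e \<in> ?P)"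
  proof (rule matching_embeds_into_matching)
    show "finite ?P"
      using PK by (rule finite_subset) simp
    show "pairwise disjnt ?P"
      using pm by (rule perfect_matching_disjoint) auto
  qed (use assms PK \<open>\<Union>?P = {..m}\<close> in auto)
  ultimately obtain h where h: "bij_betw h V {..m}" "\<And>e. e \<in> N \<Longrightarrow> h ` e \<in> ?P"
    by auto
  define k where "k u v = ?k (h u) (h v)" for u v
  have sym: "k u v = k v u" for u v
    by (simp add: k_def round_robin_commute)
  have bij: "bij_betw (k v) (V - {v}) {..<m}" if "v \<in> V" for v
  proof -
    have "h v \<le> m"
      using h(1) that by (auto dest: bij_betwE)
    moreover have "bij_betw h (V - {v}) ({..m} - {h v})"
      using h(1) that by (auto simp: bij_betw_def inj_on_def)
    ultimately have "bij_betw (?k (h v) \<circ> h) (V - {v}) {..<m}"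
      using bij_betw_round_robin[OF \<open>odd m\<close>] bij_betw_trans by blast
    moreover have "?k (h v) \<circ> h = k v"
      by (simp add: k_def fun_eq_iff)
    ultimately show ?thesis
      by simp
  qed
  show ?thesis
  proof
    show "perfect_matching V {e. e \<subseteq> V \<and> card e = 2} (colour_class V k c)" if "c < m" for c
      using that bij sym by (intro perfect_matching_colour_class[where C = "{..<m}"])
        (auto simp: colour_class_pairs)
    show "colour_class V k c \<inter> colour_class V k d = {}" if "c \<noteq> d" for c d
      using that colour_class_eq[of k, OF sym] by blast
    show "colour_class V k c \<inter> N = {}" if "c \<noteq> 0" for c
    proof (rule ccontr)
      assume "colour_class V k c \<inter> N \<noteq> {}"
      then obtain e where e: "e \<in> colour_class V k c" "e \<in> N"
        by blast
      \<comment> \<open>The image of \<open>e\<close> gets colour \<open>c\<close> by the definition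
        of \<open>k\<close>, but colour 0 as the image of an edge of \<open>N\<close>.\<close>
      have "h ` e \<in> colour_class {..m} ?k c"
      proof -
        obtain u v where uv: "e = {u, v}" "u \<in> V" "v \<in> V" "u \<noteq> v" "k u v = c"
          using e(1) unfolding colour_class_def by blast
        then have "h ` e = {h u, h v}" "h u \<in> {..m}" "h v \<in> {..m}" "h u \<noteq> h v"
          using h(1) by (auto simp: bij_betw_def dest: inj_onD)
        then show ?thesis
          using uv(5) unfolding colour_class_def k_def by blast
      qed
      with h(2)[OF e(2)] that show False
        using colour_class_eq[of ?k, OF round_robin_commute] by blast
    qed
  qed
qed

section \<open>Bounds on the matching preclusion number\<close>

text \<open>A matching \<open>M c\<close> that avoids \<open>F\<close> would survive the deletion.
  Hence \<open>F\<close> contains an edge of each \<open>M c\<close>, and disjointness makes these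
  edges distinct.\<close>

lemma card_le_matching_precluding:
  assumes "finite F" "matching_precluding V E F"
    and pm: "\<And>c. c \<in> C \<Longrightarrow> perfect_matching V E (M c)"
    and disj: "\<And>c d. c \<noteq> d \<Longrightarrow> M c \<inter> M d = {}"
  shows "card C \<le> card F"
proof -
  have "\<exists>e. e \<in> M c \<inter> F" if "c \<in> C" for c
  proof (rule ccontr)
    assume "\<nexists>e. e \<in> M c \<inter> F"
    then have "perfect_matching V (E - F) (M c)"
      using pm[OF that] by (auto simp: perfect_matching_def)
    then show False
      using assms(2) by (simp add: matching_precluding_def)
  qed
  then obtain f where f: "\<And>c. c \<in> C \<Longrightarrow> f c \<in> M c \<inter> F"
    by metis
  have "inj_on f C"
  proof (rule inj_onI)
    fix c d assume "c \<in> C" "d \<in> C" "f c = f d"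
    then have "f c \<in> M c \<inter> M d"
      using f[of c] f[of d] by simp
    then show "c = d"
      using disj by blast
  qed
  then show ?thesis
    using f assms(1) by (intro card_inj_on_le) auto
qed

text \<open>Deleting all edges is precluding once there are two vertices, so the minimum in
  \<open>mp\<close> ranges over a nonempty set.\<close>

lemma mp_attained:
  assumes "simple_graph V E" "card V \<ge> 2"
  obtains F where "finite F" "matching_precluding V E F" "card F = mp V E"
proof -
  have "finite V" "E \<subseteq> Pow V"
    using assms(1) by (auto simp: simple_graph_def)
  then have "finite E"
    by (simp add: finite_subset)
  have "\<exists>k F. matching_precluding V E F \<and> card F = k"
    using matching_precluding_all_edges[OF \<open>finite V\<close> assms(2)] by blast
  from LeastI_ex[OF this] obtain F where "matching_precluding V E F" "card F = mp V E"
    unfolding mp_def by blast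
  then show ?thesis
    using that[of F] \<open>finite E\<close> finite_subset[of F E] by (simp add: matching_precluding_def)
qed

text \<open>The edges of \<open>M\<close> are disjoint pairs with union \<open>V\<close>.\<close>

lemma even_card_if_perfect_matching:
  assumes "finite V" "E \<subseteq> {e. e \<subseteq> V \<and> card e = 2}" "perfect_matching V E M"
  shows "even (card V)"
proof -
  have M: "M \<subseteq> {e. e \<subseteq> V \<and> card e = 2}"
    using assms(2,3) by (auto simp: perfect_matching_def)
  have "pairwise disjnt M"
    using assms(3) by (rule perfect_matching_disjoint) (use assms(2) in auto)
  then have "card (\<Union>M) = sum card M"
    using M finite_subset[OF _ assms(1)] by (intro card_Union_disjoint) auto
  moreover have "\<Union>M = V"
    using assms(3) M unfolding perfect_matching_def by blast
  moreover have "sum card M = (\<Sum>e\<in>M. 2)"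
    using M by (intro sum.cong) auto
  ultimately show ?thesis
    by simp
qed

lemma mp_le_min_degree:
  assumes "simple_graph V E" "even (card V)" "V \<noteq> {}"
  shows "mp V E \<le> min_degree V E"
proof -
  have fin: "finite V" and E: "E \<subseteq> {e. e \<subseteq> V \<and> card e = 2}"
    using assms(1) by (auto simp: simple_graph_def)
  obtain v where v: "v \<in> V" "degree E v = min_degree V E"
  proof -
    have "min_degree V E \<in> degree E ` V"
      using fin assms(3) unfolding min_degree_def by (intro Min_in) auto
    then show ?thesis
      using that by auto
  qed
  let ?F = "{e \<in> E. v \<in> e}"
  have "\<not> almost_perfect_matching V (E - ?F) M" for M
  proof
    assume "almost_perfect_matching V (E - ?F) M"
    then obtain w where w: "w \<in> V" "M \<subseteq> E - ?F" "\<forall>e\<in>M. w \<notin> e"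
      "\<forall>v\<in>V - {w}. \<exists>!e. e \<in> M \<and> v \<in> e"
      unfolding almost_perfect_matching_def by (elim conjE bexE) (rule that)
    \<comment> \<open>An almost-perfect matching missing \<open>w\<close> is a perfect matching of
      the remaining vertices, whose number is odd.\<close>
    have "even (card (V - {w}))"
    proof (rule even_card_if_perfect_matching)
      show "perfect_matching (V - {w}) M M"
        using w(4) by (simp add: perfect_matching_def)
      show "M \<subseteq> {e. e \<subseteq> V - {w} \<and> card e = 2}"
      proof
        fix e assume "e \<in> M"
        then have "e \<in> E" "w \<notin> e"
          using w(2,3) by auto
        then show "e \<in> {e. e \<subseteq> V - {w} \<and> card e = 2}"
          using E by auto
      qed
    qed (use fin in simp)
    then show False
      using w(1) assms(2,3) fin by (simp add: card_gt_0_iff)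
  qed
  moreover have "\<not> perfect_matching V (E - ?F) M" for M
    using v(1) unfolding perfect_matching_def by blast
  ultimately have "matching_precluding V E ?F"
    by (auto simp: matching_precluding_def)
  then have "mp V E \<le> card ?F"
    unfolding mp_def by (intro Least_le) blast
  then show ?thesis
    using v(2) by (simp add: degree_def)
qed

text \<open>The edges and non-edges at \<open>v\<close> together are the pairs \<open>{v, u}\<close>
  with \<open>u \<noteq> v\<close>.\<close>

lemma degree_add_non_edges:
  assumes "simple_graph V E" "v \<in> V"
  shows "degree E v + card {e. e \<subseteq> V \<and> card e = 2 \<and> e \<notin> E \<and> v \<in> e} = card V - 1"
proof -
  let ?A = "{e \<in> E. v \<in> e}" and ?B = "{e. e \<subseteq> V \<and> card e = 2 \<and> e \<notin> E \<and> v \<in> e}"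
  have fin: "finite V" and E: "E \<subseteq> {e. e \<subseteq> V \<and> card e = 2}"
    using assms(1) by (auto simp: simple_graph_def)
  have "?A \<subseteq> Pow V" "?B \<subseteq> Pow V"
    using E by auto
  then have "finite ?A" "finite ?B"
    using fin by (simp_all add: finite_subset)
  then have "card ?A + card ?B = card (?A \<union> ?B)"
    by (subst card_Un_disjoint) auto
  also have "?A \<union> ?B = (\<lambda>u. {v, u}) ` (V - {v})"
  proof
    show "?A \<union> ?B \<subseteq> (\<lambda>u. {v, u}) ` (V - {v})"
    proof
      fix e assume "e \<in> ?A \<union> ?B"
      then have "e \<subseteq> V" "card e = 2" "v \<in> e"
        using E by auto
      then show "e \<in> (\<lambda>u. {v, u}) ` (V - {v})"
        by (auto simp: card_2_iff)
    qed
    show "(\<lambda>u. {v, u}) ` (V - {v}) \<subseteq> ?A \<union> ?B"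
      using assms(2) by auto
  qed
  also have "card \<dots> = card (V - {v})"
    by (intro card_image inj_onI) (auto simp: doubleton_eq_iff)
  finally show ?thesis
    using assms(2) fin by (simp add: degree_def)
qed

section \<open>The equivalence for even order\<close>

theorem theorem3p5:
  fixes V :: "'a set" and E :: "'a set set" and n :: nat
  assumes "simple_graph V E"
    and "card V = n"
    and "even n"
    and "n \<ge> 4"
  shows "mp V E = n - 2 \<longleftrightarrow> min_degree V E = n - 2"
proof -
  \<comment> \<open>\<open>m\<close> is the number of rounds and also the degree of a vertex in the
    complete graph on \<open>V\<close>.\<close>
  define m where "m = n - 1"
  have m: "card V = Suc m" "odd m" "n - 2 = m - 1" "m \<ge> 3"
    using assms by (auto simp: m_def)
  have fin: "finite V"
    using assms(1) by (simp add: simple_graph_def)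
  have ne: "V \<noteq> {}"
    using m by auto
  define N where "N = {e. e \<subseteq> V \<and> card e = 2 \<and> e \<notin> E}"
  have NK: "N \<subseteq> {e. e \<subseteq> V \<and> card e = 2}" and finN: "finite N"
    using fin by (auto simp: N_def)
  have deg: "min_degree V E + card {e \<in> N. v \<in> e} \<le> m" if "v \<in> V" for v
  proof -
    have "min_degree V E \<le> degree E v"
      using that fin by (simp add: min_degree_def)
    moreover have "degree E v + card {e \<in> N. v \<in> e} = m"
      using degree_add_non_edges[OF assms(1) that] m(1) by (simp add: N_def conj_assoc)
    ultimately show ?thesis
      by simp
  qed
  obtain F where F: "finite F" "matching_precluding V E F" "card F = mp V E"
    using mp_attained[OF assms(1)] m by auto
  have lower: "card C \<le> mp V E"
    if "m - 1 \<le> min_degree V E" "C \<subseteq> {..<m}" "N = {} \<or> 0 \<notin> C" for C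
  proof -
    \<comment> \<open>Two non-edges sharing a vertex would push its degree down to
      \<open>m - 2\<close> or less.\<close>
    have disj: "pairwise disjnt N"
    proof (rule pairwiseI, rule ccontr)
      fix e f assume ef: "e \<in> N" "f \<in> N" "e \<noteq> f" "\<not> disjnt e f"
      then obtain v where v: "v \<in> e" "v \<in> f"
        by (auto simp: disjnt_def)
      have "card {e, f} \<le> card {e \<in> N. v \<in> e}"
        using ef v finN by (intro card_mono) auto
      moreover have "v \<in> V"
        using v ef NK by auto
      ultimately show False
        using deg[of v] that(1) ef(3) m by simp
    qed
    obtain M where M: "\<And>c. c < m \<Longrightarrow> perfect_matching V {e. e \<subseteq> V \<and> card e = 2} (M c)"
      "\<And>c d. c \<noteq> d \<Longrightarrow> M c \<inter> M d = {}" "\<And>c. c \<noteq> 0 \<Longrightarrow> M c \<inter> N = {}"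
      by (rule disjoint_perfect_matchings[OF fin m(1,2) NK disj]) (rule that, blast+)
    have "perfect_matching V E (M c)" if "c \<in> C" for c
    proof -
      have pm: "perfect_matching V {e. e \<subseteq> V \<and> card e = 2} (M c)"
        using M(1) that \<open>C \<subseteq> {..<m}\<close> by auto
      then have "M c \<subseteq> {e. e \<subseteq> V \<and> card e = 2}"
        by (simp add: perfect_matching_def)
      moreover have "M c \<inter> N = {}"
        using M(3)[of c] that \<open>N = {} \<or> 0 \<notin> C\<close> by (cases "c = 0") auto
      ultimately have "M c \<subseteq> E"
        unfolding N_def by blast
      then show ?thesis
        using pm by (simp add: perfect_matching_def)
    qed
    then have "card C \<le> card F"
      using F(1,2) M(2) by (intro card_le_matching_precluding)
    then show ?thesis
      using F(3) by simp
  qed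
  have upper: "mp V E \<le> min_degree V E"
    using mp_le_min_degree assms ne by blast
  have "m - 1 \<le> mp V E" if "m - 1 \<le> min_degree V E"
    using lower[of "{1..<m}"] that by (simp add: subset_iff)
  moreover have "m \<le> mp V E" if "m \<le> min_degree V E"
  proof -
    have "N = {}"
    proof (rule ccontr)
      assume "N \<noteq> {}"
      then obtain e v where e: "e \<in> N" "v \<in> e"
        using NK by fastforce
      then have "v \<in> V"
        using NK by auto
      then have "card {e \<in> N. v \<in> e} = 0"
        using deg[of v] that by simp
      then show False
        using e finN by auto
    qed
    then show ?thesis
      using lower[of "{..<m}"] that by simp
  qed
  \<comment> \<open>If the minimum degree is \<open>m - 1\<close>, the bounds meet. If
    \<open>mp V E = m - 1\<close>, then \<open>upper\<close> makes the minimum degree at least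
    \<open>m - 1\<close>, and a value of \<open>m\<close> or more would force
    \<open>mp V E \<ge> m\<close>.\<close>
  ultimately show ?thesis
    using upper m by linarith
qed

end
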